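(* Let $A$ and $B$ be positive invertible operators on a Hilbert space such that $mA\le B\le MA$ with $0<m\le M$, and let $0\le t\le1$. Then: (i) If $M<1$, then $S(A|B)+\dfrac{\theta(t,M)}{t}A\le T_t(A|B)$. (ii) If $m\le 1\le M$, then $S(A|B)\le T_t(A|B)$. (iii) If $1<m$, then $S(A|B)+\dfrac{\theta(t,m)}{t}A\le T_t(A|B)$. Here $\theta(t,x)=\min\left\{(\ln_t x-\log x)^2,\,t^2\right\}$ for $x>0$.
   Context: For $x>0$ and $t\ne0$, $\ln_t x:=\frac{x^t-1}{t}$, and $\ln_0 x:=\log x=\lim_{t\to0}\ln_t x$. For positive invertible operators $A,B$, the relative operator entropy is $S(A|B):=A^{1/2}\log(A^{-1/2}BA^{-1/2})A^{1/2}$ and the Tsallis relative operator entropy is $T_t(A|B):=A^{1/2}\ln_t(A^{-1/2}BA^{-1/2})A^{1/2}$ (functional calculus), so $T_0(A|B)=S(A|B)$. At $t=0$ the quantity $\theta(t,x)/t$ is understood as its limit $\lim_{t\to0}\theta(t,x)/t=0$. For self-adjoint operators, $X\le Y$ means $Y-X$ is positive semidefinite. *)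

theory Defs
  imports "HOL-Analysis.Analysis" "HOL-Computational_Algebra.Polynomial"
begin

section \<open>Complex Hilbert spaces\<close>

text \<open>
  The library provides real inner product spaces only. A complex Hilbert space is a complete real
  inner product space with a compatible complex scalar multiplication and a sesquilinear inner
  product \<open>cinner\<close> (antilinear in the first argument, linear in the second) whose real part is the
  real inner product; hence \<open>norm x = sqrt (Re (cinner x x))\<close>, and every complex Hilbert space
  arises in this way.
\<close>

class complex_hilbert = real_inner + complete_space +
  fixes scaleC :: "complex \<Rightarrow> 'a \<Rightarrow> 'a"  (infixr "*\<^sub>C" 75)
    and cinner :: "'a \<Rightarrow> 'a \<Rightarrow> complex"
  assumes scaleC_of_real: "complex_of_real r *\<^sub>C x = r *\<^sub>R x"
    and scaleC_add_right: "a *\<^sub>C (x + y) = a *\<^sub>C x + a *\<^sub>C y"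
    and scaleC_add_left: "(a + b) *\<^sub>C x = a *\<^sub>C x + b *\<^sub>C x"
    and scaleC_scaleC: "a *\<^sub>C (b *\<^sub>C x) = (a * b) *\<^sub>C x"
    and cinner_commute: "cinner x y = cnj (cinner y x)"
    and cinner_add_right: "cinner x (y + z) = cinner x y + cinner x z"
    and cinner_scaleC_right: "cinner x (a *\<^sub>C y) = a * cinner x y"
    and Re_cinner: "Re (cinner x y) = inner x y"

instantiation complex :: complex_hilbert
begin

definition "scaleC_complex = ((*) :: complex \<Rightarrow> complex \<Rightarrow> complex)"

definition "cinner_complex = (\<lambda>x y :: complex. cnj x * y)"

instance
  by standard
    (simp_all add: scaleC_complex_def cinner_complex_def scaleR_conv_of_real algebra_simps
      inner_complex_def)

end

lemma cinner_scaleC_left: "cinner (a *\<^sub>C x) y = cnj a * cinner x y"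
  by (metis cinner_commute cinner_scaleC_right complex_cnj_mult)

lemma cinner_eq_imp_eq:
  fixes x y :: "'h :: complex_hilbert"
  assumes "\<And>z. cinner x z = cinner y z"
  shows "x = y"
proof -
  have "inner x z = inner y z" for z
    by (metis assms Re_cinner)
  then show ?thesis
    by (metis inner_commute vector_eq_rdot)
qed

lemma norm_scaleC:
  fixes x :: "'h :: complex_hilbert"
  shows "norm (a *\<^sub>C x) = cmod a * norm x"
proof -
  have "cinner (a *\<^sub>C x) (a *\<^sub>C x) = (a * cnj a) * cinner x x"
    by (simp add: cinner_scaleC_left cinner_scaleC_right)
  also have "\<dots> = complex_of_real ((cmod a)\<^sup>2) * cinner x x"
    by (simp only: complex_norm_square)
  finally have "inner (a *\<^sub>C x) (a *\<^sub>C x) = (cmod a)\<^sup>2 * inner x x"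
    by (simp del: of_real_power flip: Re_cinner)
  then show ?thesis
    by (simp add: norm_eq_sqrt_inner real_sqrt_mult)
qed


section \<open>Bounded operators\<close>

text \<open>
  Bounded operators are elements of \<open>'h \<Rightarrow>\<^sub>L 'h\<close>, which by itself only guarantees real linearity.
  Complex linearity is automatic for the operators considered here: see \<open>selfadjoint_imp_clinear\<close>.
\<close>

definition selfadjoint :: "('h :: complex_hilbert \<Rightarrow>\<^sub>L 'h) \<Rightarrow> bool" where
  "selfadjoint X \<longleftrightarrow> (\<forall>x y. cinner (X x) y = cinner x (X y))"

lemma selfadjoint_imp_clinear:
  assumes "selfadjoint X"
  shows "X (a *\<^sub>C x) = a *\<^sub>C X x"
  by (rule cinner_eq_imp_eq) (metis assms selfadjoint_def cinner_scaleC_left)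

definition positive_op :: "('h :: complex_hilbert \<Rightarrow>\<^sub>L 'h) \<Rightarrow> bool" where
  "positive_op X \<longleftrightarrow> selfadjoint X \<and> (\<forall>x. 0 \<le> Re (cinner x (X x)))"

definition loewner_le :: "('h :: complex_hilbert \<Rightarrow>\<^sub>L 'h) \<Rightarrow> ('h \<Rightarrow>\<^sub>L 'h) \<Rightarrow> bool"
    (infix "\<preceq>" 50) where
  "X \<preceq> Y \<longleftrightarrow> positive_op (Y - X)"

text \<open>The inverse of a complex linear operator is complex linear, so nothing is lost by
  looking for it in \<open>'h \<Rightarrow>\<^sub>L 'h\<close>.\<close>

definition invertible_op :: "('h :: complex_hilbert \<Rightarrow>\<^sub>L 'h) \<Rightarrow> bool" where
  "invertible_op X \<longleftrightarrow> (\<exists>Y. X o\<^sub>L Y = id_blinfun \<and> Y o\<^sub>L X = id_blinfun)"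

definition scalar_op :: "complex \<Rightarrow> ('h :: complex_hilbert \<Rightarrow>\<^sub>L 'h)" where
  "scalar_op z = Blinfun (\<lambda>x. z *\<^sub>C x)"

lemma scalar_op_apply [simp]: "scalar_op z x = z *\<^sub>C x"
proof -
  have "z *\<^sub>C (r *\<^sub>R y) = r *\<^sub>R (z *\<^sub>C y)" for r :: real and y :: 'a
    by (metis scaleC_of_real scaleC_scaleC mult.commute)
  then have "bounded_linear (\<lambda>x :: 'a. z *\<^sub>C x)"
    by (intro bounded_linear_intro[where K = "cmod z"])
      (simp_all add: scaleC_add_right norm_scaleC mult.commute)
  then show ?thesis
    by (simp add: scalar_op_def bounded_linear_Blinfun_apply)
qed

definition spectrum :: "('h :: complex_hilbert \<Rightarrow>\<^sub>L 'h) \<Rightarrow> complex set" where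
  "spectrum X = {z. \<not> invertible_op (X - scalar_op z)}"


section \<open>Continuous functional calculus\<close>

definition op_power :: "('h :: complex_hilbert \<Rightarrow>\<^sub>L 'h) \<Rightarrow> nat \<Rightarrow> ('h \<Rightarrow>\<^sub>L 'h)" where
  "op_power X n = (((o\<^sub>L) X) ^^ n) id_blinfun"

definition poly_op :: "real poly \<Rightarrow> ('h :: complex_hilbert \<Rightarrow>\<^sub>L 'h) \<Rightarrow> ('h \<Rightarrow>\<^sub>L 'h)" where
  "poly_op p X = (\<Sum>i\<le>degree p. coeff p i *\<^sub>R op_power X i)"

text \<open>
  For self-adjoint \<open>X\<close> (whose spectrum is a compact set of reals) and real \<open>f\<close> continuous on the
  spectrum, \<open>f(X)\<close> is the norm limit of \<open>p\<^sub>n(X)\<close> for any polynomials \<open>p\<^sub>n\<close> converging to \<open>f\<close>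
  uniformly on the spectrum. Such polynomials exist by Weierstrass, and the limit exists and does
  not depend on them because the norm of \<open>p(X)\<close> is the supremum of \<open>\<bar>p\<bar>\<close> on the spectrum.
  Nothing is claimed about other \<open>X\<close> and \<open>f\<close>.
\<close>

definition fun_calc :: "(real \<Rightarrow> real) \<Rightarrow> ('h :: complex_hilbert \<Rightarrow>\<^sub>L 'h) \<Rightarrow> ('h \<Rightarrow>\<^sub>L 'h)" where
  "fun_calc f X = (THE Y. \<forall>p :: nat \<Rightarrow> real poly.
     uniform_limit {x. complex_of_real x \<in> spectrum X} (\<lambda>n. poly (p n)) f sequentially
       \<longrightarrow> (\<lambda>n. poly_op (p n) X) \<longlonglongrightarrow> Y)"

definition op_powr :: "('h :: complex_hilbert \<Rightarrow>\<^sub>L 'h) \<Rightarrow> real \<Rightarrow> ('h \<Rightarrow>\<^sub>L 'h)" where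
  "op_powr A r = fun_calc (\<lambda>x. x powr r) A"


section \<open>Relative operator entropies\<close>

definition ln_t :: "real \<Rightarrow> real \<Rightarrow> real" where
  "ln_t t x = (if t = 0 then ln x else (x powr t - 1) / t)"

lemma ln_t_tendsto:
  assumes "0 < x"
  shows "((\<lambda>t. ln_t t x) \<longlongrightarrow> ln_t 0 x) (at 0)"
proof -
  have "((\<lambda>t. x powr t) has_real_derivative ln x) (at 0)"
    using assms by (auto intro!: derivative_eq_intros)
  then have "((\<lambda>t. (x powr t - 1) / t) \<longlongrightarrow> ln x) (at 0)"
    using assms by (simp add: has_field_derivative_iff)
  moreover have "\<forall>\<^sub>F t in at 0. ln_t t x = (x powr t - 1) / t"
    by (simp add: ln_t_def eventually_at_filter)
  ultimately show ?thesis
    by (simp add: ln_t_def[of 0] tendsto_cong)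
qed

definition theta :: "real \<Rightarrow> real \<Rightarrow> real" where
  "theta t x = min ((ln_t t x - ln x)\<^sup>2) (t\<^sup>2)"

text \<open>The quotient \<open>\<theta>(t,x)/t\<close>, extended to \<open>t = 0\<close> by its limit.\<close>

definition theta_quot :: "real \<Rightarrow> real \<Rightarrow> real" where
  "theta_quot t x = (if t = 0 then 0 else theta t x / t)"

lemma theta_quot_tendsto: "((\<lambda>t. theta t x / t) \<longlongrightarrow> theta_quot 0 x) (at 0)"
proof -
  have "\<bar>theta t x / t\<bar> \<le> \<bar>t\<bar>" for t
  proof -
    have "\<bar>theta t x\<bar> \<le> \<bar>t\<bar> * \<bar>t\<bar>"
      by (simp add: theta_def power2_eq_square flip: abs_mult)
    then show ?thesis
      by (cases "t = 0") (simp_all add: abs_divide pos_divide_le_eq)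
  qed
  moreover have "((\<lambda>t :: real. \<bar>t\<bar>) \<longlongrightarrow> 0) (at 0)"
    by (auto intro!: tendsto_eq_intros)
  ultimately show ?thesis
    by (auto simp: theta_quot_def intro!: Lim_null_comparison[where g = "\<lambda>t. \<bar>t\<bar>"])
qed

definition rel_entropy ::
    "('h :: complex_hilbert \<Rightarrow>\<^sub>L 'h) \<Rightarrow> ('h \<Rightarrow>\<^sub>L 'h) \<Rightarrow> ('h \<Rightarrow>\<^sub>L 'h)" where
  "rel_entropy A B =
     op_powr A (1/2) o\<^sub>L fun_calc ln (op_powr A (-1/2) o\<^sub>L B o\<^sub>L op_powr A (-1/2)) o\<^sub>L op_powr A (1/2)"

definition tsallis_rel_entropy ::
    "real \<Rightarrow> ('h :: complex_hilbert \<Rightarrow>\<^sub>L 'h) \<Rightarrow> ('h \<Rightarrow>\<^sub>L 'h) \<Rightarrow> ('h \<Rightarrow>\<^sub>L 'h)" where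
  "tsallis_rel_entropy t A B =
     op_powr A (1/2) o\<^sub>L fun_calc (ln_t t) (op_powr A (-1/2) o\<^sub>L B o\<^sub>L op_powr A (-1/2)) o\<^sub>L op_powr A (1/2)"

end

theory Submission
  imports Defs "HOL-Computational_Algebra.Fundamental_Theorem_Algebra"
begin

text \<open>
  With \<open>C = A\<^sup>-\<^sup>1\<^sup>/\<^sup>2 B A\<^sup>-\<^sup>1\<^sup>/\<^sup>2\<close> the hypothesis says \<open>m \<le> C \<le> M\<close>, and conjugating by \<open>A\<^sup>1\<^sup>/\<^sup>2\<close> reduces each claim
  to a scalar inequality \<open>ln x + c \<le> ln_t t x\<close> on \<open>[m, M]\<close>. The difference \<open>d(x) = ln_t t x - ln x\<close>
  is decreasing on \<open>(0, 1]\<close>, increasing on \<open>[1, \<infinity>)\<close> and vanishes at \<open>1\<close>, so its minimum over \<open>[m, M]\<close>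
  is \<open>d(M)\<close>, \<open>0\<close> or \<open>d(m)\<close> in the three cases, while \<open>min (d\<^sup>2) (t\<^sup>2) \<le> d t\<close>.

  The functional calculus rests on the bound of \<open>norm (p(X))\<close> by the supremum of \<open>\<bar>p\<bar>\<close> over the real
  spectrum: if \<open>N = norm (p(X))\<close> exceeded it, then \<open>p\<^sup>2 - N\<^sup>2\<close> would have no root in the spectrum, so
  that \<open>p(X)\<^sup>2 - N\<^sup>2\<close> would be a product of invertible linear and quadratic factors; but it is not
  bounded below.
\<close>

text \<open>Over a Banach space the bounded operators are complete, so Cauchy sequences of operators
  converge.\<close>

instance complex_hilbert \<subseteq> banach ..

section \<open>Self-adjoint operators\<close>

text \<open>Antilinearity in the first argument turns multiplication by \<open>\<i>\<close> there
  into \<open>- \<i>\<close>, which moves the imaginary part into the real one. Continuity of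
  \<open>cinner\<close> thus reduces to that of \<open>inner\<close>.\<close>

lemma cinner_eq_Complex: "cinner x y = Complex (inner x y) (inner (\<i> *\<^sub>C x) y)"
  by (rule complex_eqI)
    (simp_all add: Re_cinner cinner_scaleC_left flip: Re_cinner[of "\<i> *\<^sub>C x"])

lemma tendsto_cinner_right:
  assumes "(f \<longlongrightarrow> y) F"
  shows "((\<lambda>n. cinner x (f n)) \<longlongrightarrow> cinner x y) F"
  unfolding cinner_eq_Complex using assms by (intro tendsto_intros)

lemma tendsto_cinner_left:
  assumes "(f \<longlongrightarrow> y) F"
  shows "((\<lambda>n. cinner (f n) x) \<longlongrightarrow> cinner y x) F"
  using tendsto_cnj[OF tendsto_cinner_right[OF assms, of x]] by (simp flip: cinner_commute)

lemma cinner_add_left: "cinner (x + y) z = cinner x z + cinner y z"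
  by (metis cinner_commute cinner_add_right complex_cnj_add)

lemma cinner_scaleR_right: "cinner x (r *\<^sub>R y) = complex_of_real r * cinner x y"
  by (simp add: cinner_scaleC_right flip: scaleC_of_real)

lemma cinner_scaleR_left: "cinner (r *\<^sub>R x) y = complex_of_real r * cinner x y"
  by (simp add: cinner_scaleC_left flip: scaleC_of_real)

lemma selfadjoint_inner:
  assumes "selfadjoint X"
  shows "inner (X x) y = inner x (X y)"
  using assms by (metis Re_cinner selfadjoint_def)

lemma selfadjoint_add: "selfadjoint X \<Longrightarrow> selfadjoint Y \<Longrightarrow> selfadjoint (X + Y)"
  by (simp add: selfadjoint_def blinfun.add_left cinner_add_left cinner_add_right)

lemma selfadjoint_scaleR: "selfadjoint X \<Longrightarrow> selfadjoint (r *\<^sub>R X)"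
  by (simp add: selfadjoint_def blinfun.scaleR_left cinner_scaleR_left cinner_scaleR_right)

lemma selfadjoint_diff: "selfadjoint X \<Longrightarrow> selfadjoint Y \<Longrightarrow> selfadjoint (X - Y)"
  using selfadjoint_add[OF _ selfadjoint_scaleR[of Y "-1"]] by simp

lemma selfadjoint_id: "selfadjoint id_blinfun"
  by (simp add: selfadjoint_def)

lemma selfadjoint_zero: "selfadjoint 0"
  using selfadjoint_diff[OF selfadjoint_id selfadjoint_id] by simp

lemma selfadjoint_sandwich: "selfadjoint R \<Longrightarrow> selfadjoint X \<Longrightarrow> selfadjoint (R o\<^sub>L X o\<^sub>L R)"
  by (simp add: selfadjoint_def)

lemma selfadjoint_limit:
  assumes "\<And>n. selfadjoint (X n)" and "X \<longlonglongrightarrow> Y"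
  shows "selfadjoint Y"
  unfolding selfadjoint_def
proof (intro allI)
  fix x y
  have *: "(\<lambda>n. X n z) \<longlonglongrightarrow> Y z" for z
    by (intro tendsto_intros assms(2))
  have "(\<lambda>n. cinner (X n x) y) \<longlonglongrightarrow> cinner (Y x) y"
    by (intro tendsto_cinner_left *)
  moreover have "(\<lambda>n. cinner (X n x) y) \<longlonglongrightarrow> cinner x (Y y)"
    using assms(1) by (simp add: selfadjoint_def tendsto_cinner_right *)
  ultimately show "cinner (Y x) y = cinner x (Y y)"
    by (rule LIMSEQ_unique)
qed

section \<open>Invertibility, lower bounds and coercivity\<close>

lemma invertible_op_compose:
  assumes "invertible_op X" and "invertible_op Y"
  shows "invertible_op (X o\<^sub>L Y)"
proof -
  from assms obtain X' Y' where
    "X o\<^sub>L X' = id_blinfun" "X' o\<^sub>L X = id_blinfun" "Y o\<^sub>L Y' = id_blinfun" "Y' o\<^sub>L Y = id_blinfun"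
    unfolding invertible_op_def by blast
  then have "X (X' x) = x" "X' (X x) = x" "Y (Y' x) = x" "Y' (Y x) = x" for x
    by (metis blinfun_apply_blinfun_compose blinfun_apply_id_blinfun)+
  then show ?thesis
    unfolding invertible_op_def by (intro exI[of _ "Y' o\<^sub>L X'"]) (auto intro!: blinfun_eqI)
qed

lemma invertible_op_scaleR:
  assumes "invertible_op X" and "c \<noteq> 0"
  shows "invertible_op (c *\<^sub>R X)"
proof -
  from assms(1) obtain Y where "X o\<^sub>L Y = id_blinfun" "Y o\<^sub>L X = id_blinfun"
    unfolding invertible_op_def by blast
  then have "X (Y x) = x" "Y (X x) = x" for x
    by (metis blinfun_apply_blinfun_compose blinfun_apply_id_blinfun)+
  then show ?thesis
    using assms(2) unfolding invertible_op_def
    by (intro exI[of _ "inverse c *\<^sub>R Y"])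
      (auto intro!: blinfun_eqI simp: blinfun.scaleR_left blinfun.scaleR_right)
qed

lemma invertible_op_bounded_below:
  assumes "invertible_op X"
  obtains K where "K > 0" and "\<And>x. norm x \<le> K * norm (X x)"
proof -
  from assms obtain Y where "Y o\<^sub>L X = id_blinfun"
    unfolding invertible_op_def by blast
  then have "norm x \<le> norm Y * norm (X x)" for x
    by (metis blinfun_apply_blinfun_compose blinfun_apply_id_blinfun norm_blinfun)
  \<comment> \<open>The summand 1 keeps the constant positive even if \<open>norm Y = 0\<close>, as
    on the trivial space.\<close>
  moreover have "norm Y * norm (X x) \<le> (norm Y + 1) * norm (X x)" for x
    by (rule mult_right_mono) simp_all
  ultimately have "norm x \<le> (norm Y + 1) * norm (X x)" for x
    by (rule order_trans)
  then show thesis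
    using that[of "norm Y + 1"] by (simp add: add_nonneg_pos)
qed

text \<open>Lax--Milgram: for small \<open>s > 0\<close> the map \<open>x \<mapsto> x - s (T x - y)\<close> is a contraction.\<close>

lemma coercive_imp_invertible:
  fixes T :: "'h :: complex_hilbert \<Rightarrow>\<^sub>L 'h"
  assumes "\<delta> > 0" and coercive: "\<And>x. \<delta> * (norm x)\<^sup>2 \<le> inner x (T x)"
  shows "invertible_op T"
proof -
  have below: "\<delta> * norm x \<le> norm (T x)" for x
  proof (cases "x = 0")
    case False
    have "norm x * (\<delta> * norm x) \<le> norm x * norm (T x)"
      using coercive[of x] norm_cauchy_schwarz[of x "T x"] by (simp add: power2_eq_square ac_simps)
    with False show ?thesis
      by simp
  qed simp
  \<comment> \<open>Adding \<open>\<delta>\<close> makes \<open>K\<close> positive and at least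
    \<open>\<delta>\<close>, so that the radicand in \<open>c\<close> below is nonnegative.\<close>
  define K where "K = norm T + \<delta>"
  have K: "K > 0" "\<delta> \<le> K" "norm T \<le> K"
    using \<open>\<delta> > 0\<close> by (simp_all add: K_def add_nonneg_pos)
  \<comment> \<open>The squared contraction factor is at most
    \<open>1 - 2 * s * \<delta> + s^2 * K^2\<close>. This \<open>s\<close> minimises it, and
    \<open>c^2\<close> is the minimum.\<close>
  define s where "s = \<delta> / K\<^sup>2"
  define c where "c = sqrt (1 - \<delta>\<^sup>2 / K\<^sup>2)"
  have "\<delta>\<^sup>2 / K\<^sup>2 \<le> 1" "0 < \<delta>\<^sup>2 / K\<^sup>2"
    using K \<open>\<delta> > 0\<close> by (simp_all add: power_mono)
  then have c: "0 \<le> c" "c < 1" "c\<^sup>2 = 1 - \<delta>\<^sup>2 / K\<^sup>2"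
    by (simp_all add: c_def)
  have contr: "norm (x - s *\<^sub>R T x) \<le> c * norm x" for x
  proof -
    have "norm (T x) \<le> K * norm x"
      using norm_blinfun[of T x] K(3) by (smt (verit) mult_right_mono norm_ge_zero)
    then have "(norm (T x))\<^sup>2 \<le> K\<^sup>2 * (norm x)\<^sup>2"
      by (simp add: power_mono flip: power_mult_distrib)
    then have "s\<^sup>2 * (norm (T x))\<^sup>2 \<le> s\<^sup>2 * (K\<^sup>2 * (norm x)\<^sup>2)"
      by (rule mult_left_mono) simp
    moreover have "s\<^sup>2 * (K\<^sup>2 * (norm x)\<^sup>2) = \<delta>\<^sup>2 / K\<^sup>2 * (norm x)\<^sup>2"
      using K by (simp add: s_def power2_eq_square)
    moreover have "2 * s * inner x (T x) \<ge> 2 * s * (\<delta> * (norm x)\<^sup>2)"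
      using K \<open>\<delta> > 0\<close> by (intro mult_left_mono coercive) (simp add: s_def)
    moreover have "2 * s * (\<delta> * (norm x)\<^sup>2) = 2 * (\<delta>\<^sup>2 / K\<^sup>2 * (norm x)\<^sup>2)"
      by (simp add: s_def power2_eq_square)
    moreover have "(norm (x - s *\<^sub>R T x))\<^sup>2 = (norm x)\<^sup>2 - 2 * s * inner x (T x) + s\<^sup>2 * (norm (T x))\<^sup>2"
      unfolding power2_norm_eq_inner
      by (simp add: inner_diff_left inner_diff_right inner_commute[of "T x" x] power2_eq_square
          right_diff_distrib)
    moreover have "(c * norm x)\<^sup>2 = (norm x)\<^sup>2 - \<delta>\<^sup>2 / K\<^sup>2 * (norm x)\<^sup>2"
      by (simp add: power_mult_distrib c(3) left_diff_distrib)
    ultimately have "(norm (x - s *\<^sub>R T x))\<^sup>2 \<le> (c * norm x)\<^sup>2"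
      by linarith
    then show ?thesis
      by (rule power2_le_imp_le) (simp add: c(1))
  qed
  have "s > 0"
    using K \<open>\<delta> > 0\<close> by (simp add: s_def)
  have "\<exists>x. T x = y" for y
  proof -
    \<comment> \<open>Since \<open>s > 0\<close>, a fixed point is exactly a solution of
      \<open>T x = y\<close>.\<close>
    have "\<exists>!x. x - s *\<^sub>R (T x - y) = x"
    proof (rule banach_fix_type[OF c(1,2)], intro allI)
      fix u v
      show "dist (u - s *\<^sub>R (T u - y)) (v - s *\<^sub>R (T v - y)) \<le> c * dist u v"
        using contr[of "u - v"] by (simp add: dist_norm blinfun.diff_right algebra_simps)
    qed
    with \<open>s > 0\<close> show ?thesis
      by auto
  qed
  then obtain g where g: "T (g y) = y" for y
    by metis
  have inj: "x = y" if "T x = T y" for x y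
    using below[of "x - y"] that \<open>\<delta> > 0\<close> by (simp add: blinfun.diff_right mult_le_0_iff)
  have gT: "g (T x) = x" for x
    by (rule inj) (rule g)
  have "bounded_linear g"
  proof (rule bounded_linear_intro[where K = "1 / \<delta>"])
    show "g (x + y) = g x + g y" for x y
      by (rule inj) (simp add: g blinfun.add_right)
    show "g (r *\<^sub>R x) = r *\<^sub>R g x" for r x
      by (rule inj) (simp add: g blinfun.scaleR_right)
    show "norm (g y) \<le> norm y * (1 / \<delta>)" for y
      using below[of "g y"] \<open>\<delta> > 0\<close> by (simp add: g field_simps)
  qed
  then have "Blinfun g y = g y" for y
    by (simp add: bounded_linear_Blinfun_apply)
  then show ?thesis
    unfolding invertible_op_def
    by (intro exI[of _ "Blinfun g"]) (simp add: g gT blinfun_eqI)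
qed

lemma positive_op_inner: "positive_op X \<Longrightarrow> 0 \<le> inner x (X x)"
  by (simp add: positive_op_def Re_cinner)

lemma positive_op_sandwich:
  assumes "selfadjoint R" and "positive_op X"
  shows "positive_op (R o\<^sub>L X o\<^sub>L R)"
  unfolding positive_op_def
proof (intro conjI allI)
  show "selfadjoint (R o\<^sub>L X o\<^sub>L R)"
    using assms by (simp add: selfadjoint_sandwich positive_op_def)
  show "0 \<le> Re (cinner x ((R o\<^sub>L X o\<^sub>L R) x))" for x
    using positive_op_inner[OF assms(2), of "R x"] selfadjoint_inner[OF assms(1), of x]
    by (simp add: Re_cinner)
qed

text \<open>Testing positivity on \<open>x - s A x\<close> gives \<open>inner x (A x) \<ge> norm (A x)\<^sup>2 / K\<close>.\<close>

lemma positive_invertible_imp_coercive: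
  assumes "positive_op A" and "invertible_op A"
  obtains \<delta> where "\<delta> > 0" and "\<And>x. \<delta> * (norm x)\<^sup>2 \<le> inner x (A x)"
proof -
  obtain L where L: "L > 0" "\<And>x. norm x \<le> L * norm (A x)"
    using invertible_op_bounded_below[OF assms(2)] by blast
  define K where "K = norm A + 1"
  have "K > 0"
    by (simp add: K_def add_nonneg_pos)
  \<comment> \<open>With this \<open>s\<close> the quadratic term in \<open>s\<close> is at most
    \<open>s * (norm (A x))^2\<close>, half of the cross term that it has to be set against.\<close>
  define s where "s = 1 / K"
  have "1 / (L\<^sup>2 * K) * (norm x)\<^sup>2 \<le> inner x (A x)" for x
  proof -
    have sym: "inner (A x) y = inner x (A y)" for x y
      using assms(1) by (simp add: positive_op_def selfadjoint_inner)
    have "0 \<le> inner (x - s *\<^sub>R A x) (A (x - s *\<^sub>R A x))"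
      by (rule positive_op_inner[OF assms(1)])
    also have "\<dots> = inner x (A x) - 2 * s * (norm (A x))\<^sup>2 + s\<^sup>2 * inner (A x) (A (A x))"
      unfolding power2_norm_eq_inner
      by (simp add: blinfun.diff_right blinfun.scaleR_right inner_diff_left inner_diff_right
          power2_eq_square algebra_simps flip: sym[of x "A x"])
    finally have 1: "2 * s * (norm (A x))\<^sup>2 - s\<^sup>2 * inner (A x) (A (A x)) \<le> inner x (A x)"
      by linarith
    have "inner (A x) (A (A x)) \<le> norm (A x) * (norm A * norm (A x))"
      by (rule order_trans[OF norm_cauchy_schwarz mult_left_mono[OF norm_blinfun]]) simp
    also have "\<dots> \<le> K * (norm (A x))\<^sup>2"
      by (simp add: K_def power2_eq_square algebra_simps)
    finally have "s\<^sup>2 * inner (A x) (A (A x)) \<le> s\<^sup>2 * (K * (norm (A x))\<^sup>2)"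
      by (rule mult_left_mono) simp
    also have "\<dots> = s * (norm (A x))\<^sup>2"
      using \<open>K > 0\<close> by (simp add: s_def power2_eq_square)
    finally have 2: "s * (norm (A x))\<^sup>2 \<le> inner x (A x)"
      using 1 by linarith
    have "(norm x)\<^sup>2 \<le> L\<^sup>2 * (norm (A x))\<^sup>2"
      using L(2)[of x] by (simp add: power_mono flip: power_mult_distrib)
    then have "1 / (L\<^sup>2 * K) * (norm x)\<^sup>2 \<le> 1 / (L\<^sup>2 * K) * (L\<^sup>2 * (norm (A x))\<^sup>2)"
      using \<open>K > 0\<close> by (intro mult_left_mono) simp_all
    also have "\<dots> = s * (norm (A x))\<^sup>2"
      using L(1) by (simp add: s_def)
    finally show ?thesis
      using 2 by linarith
  qed
  moreover have "1 / (L\<^sup>2 * K) > 0"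
    using L(1) \<open>K > 0\<close> by simp
  ultimately show thesis
    using that by blast
qed


section \<open>Polynomials of an operator\<close>

lemma op_power_0 [simp]: "op_power X 0 = id_blinfun"
  by (simp add: op_power_def)

lemma op_power_Suc: "op_power X (Suc n) = X o\<^sub>L op_power X n"
  by (simp add: op_power_def)

text \<open>Padding with zero coefficients lets polynomials of different degrees be summed over a
  common range.\<close>

lemma poly_op_altdef:
  assumes "degree p \<le> n"
  shows "poly_op p X = (\<Sum>i\<le>n. coeff p i *\<^sub>R op_power X i)"
  unfolding poly_op_def using assms
  by (intro sum.mono_neutral_left) (auto simp: coeff_eq_0)

lemma poly_op_add: "poly_op (p + q) X = poly_op p X + poly_op q X"
proof -
  let ?n = "max (degree p) (degree q)"
  show ?thesis
    using degree_add_le_max[of p q]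
    by (simp add: poly_op_altdef[of _ ?n] scaleR_left_distrib sum.distrib)
qed

lemma poly_op_smult: "poly_op (smult c p) X = c *\<^sub>R poly_op p X"
  by (simp add: poly_op_altdef[of _ "degree p"] scaleR_right.sum)

lemma poly_op_0 [simp]: "poly_op 0 X = 0"
  by (simp add: poly_op_def)

lemma poly_op_diff: "poly_op (p - q) X = poly_op p X - poly_op q X"
  using poly_op_add[of p "smult (-1) q" X] poly_op_smult[of "-1" q X] by simp

text \<open>Horner's recursion, the step for inductions over \<open>pCons\<close>.\<close>

lemma poly_op_pCons: "poly_op (pCons a p) X = a *\<^sub>R id_blinfun + (X o\<^sub>L poly_op p X)"
proof -
  have "poly_op (pCons a p) X =
      (\<Sum>i\<le>Suc (degree p). coeff (pCons a p) i *\<^sub>R op_power X i)"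
    by (rule poly_op_altdef) (simp add: degree_pCons_le)
  also have "\<dots> = a *\<^sub>R id_blinfun + (\<Sum>i\<le>degree p. X o\<^sub>L (coeff p i *\<^sub>R op_power X i))"
    by (simp add: sum.atMost_Suc_shift op_power_Suc del: sum.atMost_Suc)
      (simp add: bounded_bilinear.scaleR_right[OF bounded_bilinear_blinfun_compose])
  finally show ?thesis
    by (simp add: poly_op_def bounded_bilinear.sum_right[OF bounded_bilinear_blinfun_compose])
qed

lemma poly_op_const [simp]: "poly_op [:c:] X = c *\<^sub>R id_blinfun"
  by (simp add: poly_op_pCons)

lemma poly_op_X [simp]: "poly_op [:0, 1:] X = X"
  by (auto simp: poly_op_pCons intro!: blinfun_eqI)

lemma poly_op_mult: "poly_op (p * q) X = poly_op p X o\<^sub>L poly_op q X"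
proof (induction p)
  case (pCons a p)
  show ?case
    by (rule blinfun_eqI)
      (simp add: poly_op_add poly_op_smult poly_op_pCons pCons.IH blinfun.add_left
        blinfun.scaleR_left)
qed simp

text \<open>A product of commuting self-adjoint operators is self-adjoint, and \<open>X\<close>
  commutes with its polynomials because multiplication of polynomials is commutative.\<close>

lemma selfadjoint_poly_op:
  assumes "selfadjoint X"
  shows "selfadjoint (poly_op p X)"
proof -
  have commute: "X o\<^sub>L poly_op q X = poly_op q X o\<^sub>L X" for q
    using poly_op_mult[of "[:0, 1:]" q X] poly_op_mult[of q "[:0, 1:]" X]
    by (simp add: mult.commute del: mult_pCons_left mult_pCons_right)
  show ?thesis
  proof (induction p)
    case (pCons a p)
    have "X (poly_op p X y) = poly_op p X (X y)" for y
      by (metis commute blinfun_apply_blinfun_compose)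
    then have "selfadjoint (X o\<^sub>L poly_op p X)"
      using assms pCons.IH by (simp add: selfadjoint_def)
    then show ?case
      by (simp add: poly_op_pCons selfadjoint_add selfadjoint_scaleR selfadjoint_id)
  qed (simp add: selfadjoint_zero)
qed


section \<open>Spectral bounds\<close>

text \<open>This is the set on which \<open>fun_calc\<close> asks for uniform convergence.\<close>

definition real_spectrum :: "('h :: complex_hilbert \<Rightarrow>\<^sub>L 'h) \<Rightarrow> real set" where
  "real_spectrum X = {x. complex_of_real x \<in> spectrum X}"

lemma scalar_op_of_real: "scalar_op (complex_of_real r) = r *\<^sub>R id_blinfun"
  by (rule blinfun_eqI) (simp add: scaleC_of_real blinfun.scaleR_left)

lemma real_spectrum_iff: "r \<in> real_spectrum X \<longleftrightarrow> \<not> invertible_op (X - r *\<^sub>R id_blinfun)"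
  by (simp add: real_spectrum_def spectrum_def scalar_op_of_real)

text \<open>The operator is \<open>(X - a)^2 + b^2\<close>. The square is positive because
  \<open>X - a\<close> is self-adjoint, so \<open>b^2\<close> is a coercivity constant.\<close>

lemma invertible_op_quadratic:
  assumes "selfadjoint X" and "b \<noteq> 0"
  shows "invertible_op (poly_op [:a\<^sup>2 + b\<^sup>2, - 2 * a, 1:] X)"
proof (rule coercive_imp_invertible)
  show "b\<^sup>2 * (norm x)\<^sup>2 \<le> inner x (poly_op [:a\<^sup>2 + b\<^sup>2, - 2 * a, 1:] X x)" for x
  proof -
    let ?Y = "poly_op [:- a, 1:] X"
    have "[:a\<^sup>2 + b\<^sup>2, - 2 * a, 1:] = [:- a, 1:] * [:- a, 1:] + [:b\<^sup>2:]"
      by (simp add: power2_eq_square)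
    then have "inner x (poly_op [:a\<^sup>2 + b\<^sup>2, - 2 * a, 1:] X x) = inner x (?Y (?Y x)) + b\<^sup>2 * (norm x)\<^sup>2"
      by (simp only: poly_op_add poly_op_mult poly_op_const)
        (simp add: blinfun.add_left blinfun.scaleR_left inner_add_right power2_norm_eq_inner)
    also have "inner x (?Y (?Y x)) = inner (?Y x) (?Y x)"
      by (simp add: selfadjoint_inner selfadjoint_poly_op assms(1))
    finally show ?thesis
      by simp
  qed
qed (use assms(2) in simp)

section \<open>Factors of real polynomials and invertibility of \<open>p(X)\<close>\<close>

lemma complex_poly_of_real_pCons:
  "poly (map_poly complex_of_real (pCons a p)) z = complex_of_real a + z * poly (map_poly complex_of_real p) z"
  by (simp add: map_poly_pCons)

lemma complex_poly_of_real_add: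
  "poly (map_poly complex_of_real (p + q)) z =
    poly (map_poly complex_of_real p) z + poly (map_poly complex_of_real q) z"
  by (induction p q rule: poly_induct2) (simp_all add: complex_poly_of_real_pCons algebra_simps)

lemma complex_poly_of_real_mult:
  "poly (map_poly complex_of_real (p * q)) z =
    poly (map_poly complex_of_real p) z * poly (map_poly complex_of_real q) z"
proof (induction p)
  case (pCons a p)
  have "poly (map_poly complex_of_real (smult a q)) z = complex_of_real a * poly (map_poly complex_of_real q) z"
    by (induction q) (simp_all add: complex_poly_of_real_pCons algebra_simps)
  then show ?case
    by (simp add: complex_poly_of_real_add complex_poly_of_real_pCons pCons.IH algebra_simps)
qed simp

text \<open>The remainder \<open>u + v * x\<close> is real and vanishes at
  \<open>a + \<i> * b\<close>. Its imaginary part \<open>v * b\<close> gives \<open>v = 0\<close>,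
  and then \<open>u = 0\<close>.\<close>

lemma real_quadratic_dvd:
  fixes p :: "real poly"
  assumes "poly (map_poly complex_of_real p) (Complex a b) = 0" and "b \<noteq> 0"
  shows "[:a\<^sup>2 + b\<^sup>2, - 2 * a, 1:] dvd p"
proof -
  let ?d = "[:a\<^sup>2 + b\<^sup>2, - 2 * a, 1:]" and ?z = "Complex a b"
  let ?r = "p mod ?d"
  have "?r = 0 \<or> degree ?r < degree ?d"
    by (rule degree_mod_less) simp
  then have "degree ?r \<le> 1"
    by auto
  moreover obtain u s where "?r = pCons u s"
    by (rule pCons_cases)
  ultimately have "degree s = 0"
    by (simp split: if_splits)
  then obtain v where r: "?r = [:u, v:]"
    using \<open>?r = pCons u s\<close> by (metis degree_eq_zeroE)
  have "poly (map_poly complex_of_real ?d) ?z = 0"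
    by (simp add: complex_poly_of_real_pCons complex_eq_iff power2_eq_square algebra_simps)
  moreover have "p = ?d * (p div ?d) + ?r"
    by (rule mult_div_mod_eq[symmetric])
  ultimately have "poly (map_poly complex_of_real ?r) ?z = 0"
    using assms(1) by (metis complex_poly_of_real_add complex_poly_of_real_mult mult_zero_left add_0)
  then have "u = 0 \<and> v = 0"
    unfolding r using assms(2) by (auto simp: complex_poly_of_real_pCons complex_eq_iff)
  then show ?thesis
    using r by (simp add: mod_eq_0_iff_dvd)
qed

text \<open>Induction on the degree. A complex root of \<open>p\<close> yields either a linear
  factor whose real root lies off the spectrum or a real quadratic factor without real roots. Both
  give invertible operators, and the cofactor inherits the hypothesis.\<close>

lemma invertible_poly_op:
  assumes "selfadjoint X" and "p \<noteq> 0" and "\<And>r. r \<in> real_spectrum X \<Longrightarrow> poly p r \<noteq> 0"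
  shows "invertible_op (poly_op p X)"
  using assms(2,3)
proof (induction "degree p" arbitrary: p rule: less_induct)
  case less
  have step: ?case if "p = d * q" "degree d \<noteq> 0" "invertible_op (poly_op d X)" for d q
  proof -
    from that(1) less.prems(1) have "d \<noteq> 0" "q \<noteq> 0"
      by auto
    then have "degree q < degree p"
      using that(1,2) by (simp add: degree_mult_eq)
    then have "invertible_op (poly_op q X)"
      using less \<open>q \<noteq> 0\<close> that(1) by auto
    then show ?case
      using that by (simp add: poly_op_mult invertible_op_compose)
  qed
  show ?case
  proof (cases "degree p = 0")
    case True
    then obtain c where c: "p = [:c:]"
      by (rule degree_eq_zeroE)
    then have "c \<noteq> 0"
      using less.prems(1) by simp
    moreover have "invertible_op id_blinfun"
      unfolding invertible_op_def by (intro exI[of _ id_blinfun]) (auto intro!: blinfun_eqI)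
    ultimately show ?thesis
      by (simp add: c) (rule invertible_op_scaleR)
  next
    case False
    have "\<not> constant (poly (map_poly complex_of_real p))"
      using False by (simp add: constant_degree degree_map_poly)
    then obtain z where "poly (map_poly complex_of_real p) z = 0"
      using fundamental_theorem_of_algebra by blast
    then obtain a b where ab: "poly (map_poly complex_of_real p) (Complex a b) = 0"
      by (cases z) auto
    show ?thesis
    proof (cases "b = 0")
      case True
      have "poly (map_poly complex_of_real q) (complex_of_real a) = complex_of_real (poly q a)" for q
        by (induction q) (simp_all add: complex_poly_of_real_pCons)
      then have "poly p a = 0"
        using ab True by (metis complex_of_real_def of_real_eq_0_iff)
      then obtain q where "p = [:- a, 1:] * q"
        by (auto simp: poly_eq_0_iff_dvd)
      moreover have "invertible_op (X - a *\<^sub>R id_blinfun)"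
        using less.prems(2) \<open>poly p a = 0\<close> by (auto simp: real_spectrum_iff)
      moreover have "poly_op [:- a, 1:] X = X - a *\<^sub>R id_blinfun"
        by (rule blinfun_eqI) (simp add: poly_op_pCons blinfun.add_left blinfun.diff_left
            blinfun.scaleR_left blinfun.minus_left)
      ultimately show ?thesis
        by (intro step[of "[:- a, 1:]" q]) simp_all
    next
      case nz: False
      from real_quadratic_dvd[OF ab nz] obtain q where "p = [:a\<^sup>2 + b\<^sup>2, - 2 * a, 1:] * q"
        by blast
      then show ?thesis
        by (rule step) (simp_all only: invertible_op_quadratic[OF assms(1) nz], simp)
    qed
  qed
qed

text \<open>Some vectors are stretched by almost \<open>norm Y\<close>, and on those \<open>Y\<^sup>2 - norm Y\<^sup>2\<close> is small; so this
  operator is invertible on the trivial space only.\<close>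

lemma invertible_square_minus_norm_imp_trivial:
  fixes Y :: "'h :: complex_hilbert \<Rightarrow>\<^sub>L 'h"
  assumes "selfadjoint Y" and "invertible_op (poly_op [:- (norm Y)\<^sup>2, 0, 1:] Y)"
  shows "x = (0 :: 'h)"
proof (rule ccontr)
  assume "x \<noteq> 0"
  let ?N = "norm Y" and ?Z = "poly_op [:- (norm Y)\<^sup>2, 0, 1:] Y"
  obtain K where K: "K > 0" "\<And>x. norm x \<le> K * norm (?Z x)"
    using invertible_op_bounded_below[OF assms(2)] by blast
  have Z: "?Z x = Y (Y x) - ?N\<^sup>2 *\<^sub>R x" for x
    by (simp add: poly_op_pCons blinfun.diff_left blinfun.scaleR_left)
  \<comment> \<open>Expand the square of \<open>norm (?Z y)\<close>, use self-adjointness for the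
    cross term, and bound \<open>norm (Y (Y y))\<close> by \<open>?N^2 * norm y\<close>.\<close>
  have *: "(norm y)\<^sup>2 \<le> K\<^sup>2 * (2 * ?N ^ 4 * (norm y)\<^sup>2 - 2 * ?N\<^sup>2 * (norm (Y y))\<^sup>2)" for y
  proof -
    have "inner (Y (Y y)) y = inner (Y y) (Y y)"
      by (simp add: selfadjoint_inner assms(1))
    then have eq: "(norm (?Z y))\<^sup>2 = (norm (Y (Y y)))\<^sup>2 - 2 * ?N\<^sup>2 * (norm (Y y))\<^sup>2 + ?N ^ 4 * (norm y)\<^sup>2"
      unfolding Z power2_norm_eq_inner
      by (simp add: inner_diff_left inner_diff_right inner_commute power2_eq_square power4_eq_xxxx
          algebra_simps)
    have "norm (Y (Y y)) \<le> ?N * (?N * norm y)"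
      by (rule order_trans[OF norm_blinfun mult_left_mono[OF norm_blinfun]]) simp
    then have "(norm (Y (Y y)))\<^sup>2 \<le> (?N * (?N * norm y))\<^sup>2"
      by (simp add: power_mono)
    also have "\<dots> = ?N ^ 4 * (norm y)\<^sup>2"
      by (simp add: power2_eq_square power4_eq_xxxx)
    finally have "(norm (?Z y))\<^sup>2 \<le> 2 * ?N ^ 4 * (norm y)\<^sup>2 - 2 * ?N\<^sup>2 * (norm (Y y))\<^sup>2"
      using eq by linarith
    then have "K\<^sup>2 * (norm (?Z y))\<^sup>2 \<le> K\<^sup>2 * (2 * ?N ^ 4 * (norm y)\<^sup>2 - 2 * ?N\<^sup>2 * (norm (Y y))\<^sup>2)"
      by (rule mult_left_mono) simp
    moreover have "(norm y)\<^sup>2 \<le> (K * norm (?Z y))\<^sup>2"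
      using K(2)[of y] by (simp add: power_mono)
    ultimately show ?thesis
      by (simp add: power_mult_distrib)
  qed
  \<comment> \<open>For \<open>?N = 0\<close> the estimate \<open>*\<close> would force
    \<open>x = 0\<close>.\<close>
  have "?N > 0"
    using *[of x] \<open>x \<noteq> 0\<close> by (cases "?N = 0") auto
  \<comment> \<open>Dividing \<open>*\<close> by \<open>2 * K^2 * ?N^2\<close> leaves exactly this
    gap below \<open>?N^2\<close>.\<close>
  define e where "e = 1 / (2 * K\<^sup>2 * ?N\<^sup>2)"
  have "e > 0"
    using K \<open>?N > 0\<close> by (simp add: e_def)
  have **: "(norm (Y y))\<^sup>2 \<le> (?N\<^sup>2 - e) * (norm y)\<^sup>2" for y
  proof -
    have "2 * K\<^sup>2 * ?N\<^sup>2 > 0"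
      using K \<open>?N > 0\<close> by simp
    moreover have "2 * K\<^sup>2 * ?N\<^sup>2 * (norm (Y y))\<^sup>2 \<le> 2 * K\<^sup>2 * ?N\<^sup>2 * ((?N\<^sup>2 - e) * (norm y)\<^sup>2)"
    proof -
      have "2 * K\<^sup>2 * ?N\<^sup>2 * e = 1"
        using K \<open>?N > 0\<close> by (simp add: e_def)
      then have eq: "2 * K\<^sup>2 * ?N\<^sup>2 * ((?N\<^sup>2 - e) * (norm y)\<^sup>2) = 2 * K\<^sup>2 * ?N ^ 4 * (norm y)\<^sup>2 - (norm y)\<^sup>2"
        by (simp add: algebra_simps power2_eq_square power4_eq_xxxx)
      show ?thesis
        unfolding eq using *[of y] by (simp add: algebra_simps)
    qed
    ultimately show ?thesis
      by (simp only: mult_le_cancel_left_pos)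
  qed
  \<comment> \<open>The nonzero vector \<open>x\<close> supplies the sign that the square root below
    requires.\<close>
  have "0 \<le> (?N\<^sup>2 - e) * (norm x)\<^sup>2"
    using **[of x] by (meson order_trans zero_le_power2)
  then have "0 \<le> ?N\<^sup>2 - e"
    using \<open>x \<noteq> 0\<close> by (simp add: zero_le_mult_iff)
  \<comment> \<open>By \<open>**\<close>, the number \<open>sqrt (?N^2 - e)\<close> bounds the
    operator norm, although it is smaller than \<open>?N\<close>.\<close>
  have "?N \<le> sqrt (?N\<^sup>2 - e)"
  proof (rule norm_blinfun_bound)
    show "norm (Y y) \<le> sqrt (?N\<^sup>2 - e) * norm y" for y
    proof (rule power2_le_imp_le)
      show "(norm (Y y))\<^sup>2 \<le> (sqrt (?N\<^sup>2 - e) * norm y)\<^sup>2"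
        unfolding power_mult_distrib real_sqrt_pow2[OF \<open>0 \<le> ?N\<^sup>2 - e\<close>] by (rule **)
    qed (use \<open>0 \<le> ?N\<^sup>2 - e\<close> in simp)
  qed (use \<open>0 \<le> ?N\<^sup>2 - e\<close> in simp)
  then have "?N\<^sup>2 \<le> (sqrt (?N\<^sup>2 - e))\<^sup>2"
    by (rule power_mono) simp
  also have "\<dots> = ?N\<^sup>2 - e"
    by (rule real_sqrt_pow2) fact
  finally have "?N\<^sup>2 \<le> ?N\<^sup>2 - e" .
  with \<open>e > 0\<close> show False
    by simp
qed

text \<open>A bound \<open>c\<close> instead of a supremum also covers the empty spectrum on the
  trivial space.\<close>

lemma norm_poly_op_le:
  fixes X :: "'h :: complex_hilbert \<Rightarrow>\<^sub>L 'h"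
  assumes "selfadjoint X" and "0 \<le> c" and "\<And>r. r \<in> real_spectrum X \<Longrightarrow> \<bar>poly p r\<bar> \<le> c"
  shows "norm (poly_op p X) \<le> c"
proof (rule ccontr)
  let ?N = "norm (poly_op p X)"
  assume "\<not> ?N \<le> c"
  then have "c < ?N" by simp
  have nontrivial: "\<not> (\<forall>x :: 'h. x = 0)"
  proof
    assume "\<forall>x :: 'h. x = 0"
    then have "poly_op p X = 0"
      by (intro blinfun_eqI) metis
    with \<open>c < ?N\<close> assms(2) show False
      by simp
  qed
  \<comment> \<open>A root of \<open>?q\<close> in the real spectrum would give
    \<open>\<bar>poly p r\<bar> = ?N > c\<close>.\<close>
  let ?q = "p * p - [:?N\<^sup>2:]"
  have root: "poly ?q r \<noteq> 0" if "r \<in> real_spectrum X" for r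
  proof
    assume "poly ?q r = 0"
    then have "(poly p r)\<^sup>2 = ?N\<^sup>2"
      by (simp add: power2_eq_square)
    then have "\<bar>poly p r\<bar> = ?N"
      by (metis abs_norm_cancel power2_eq_iff_nonneg power2_abs abs_ge_zero)
    with assms(3)[OF that] \<open>c < ?N\<close> show False
      by simp
  qed
  show False
  proof (cases "?q = 0")
    case False
    then have "invertible_op (poly_op ?q X)"
      using root by (intro invertible_poly_op assms(1))
    moreover have "poly_op ?q X = poly_op [:- ?N\<^sup>2, 0, 1:] (poly_op p X)"
      by (rule blinfun_eqI)
        (simp add: poly_op_diff poly_op_mult poly_op_pCons blinfun.add_left blinfun.diff_left
          blinfun.scaleR_left blinfun.add_right blinfun.minus_left)
    ultimately have "invertible_op (poly_op [:- ?N\<^sup>2, 0, 1:] (poly_op p X))"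
      by simp
    then show False
      using invertible_square_minus_norm_imp_trivial selfadjoint_poly_op[OF assms(1)] nontrivial
      by blast
  next
    \<comment> \<open>If \<open>?q = 0\<close>, every real number is a root of it, so the real
      spectrum is empty. The same argument, applied to \<open>X\<close> in place of
      \<open>p(X)\<close>, is then contradictory on a nontrivial space.\<close>
    case True
    then have "real_spectrum X = {}"
      using root by (metis equals0I poly_0)
    then have "invertible_op (poly_op [:- (norm X)\<^sup>2, 0, 1:] X)"
      by (intro invertible_poly_op assms(1)) simp_all
    then show False
      using invertible_square_minus_norm_imp_trivial assms(1) nontrivial by blast
  qed
qed

text \<open>For \<open>r < a\<close> the operator \<open>X - r\<close> is coercive with constant
  \<open>a - r\<close>; for \<open>r > b\<close> the operator \<open>r - X\<close> is coercive with
  constant \<open>r - b\<close>.\<close>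

lemma real_spectrum_subset:
  fixes X :: "'h :: complex_hilbert \<Rightarrow>\<^sub>L 'h"
  assumes "\<And>x. a * (norm x)\<^sup>2 \<le> inner x (X x)" and "\<And>x. inner x (X x) \<le> b * (norm x)\<^sup>2"
  shows "real_spectrum X \<subseteq> {a..b}"
proof
  fix r assume r: "r \<in> real_spectrum X"
  have eq: "inner x ((X - r *\<^sub>R id_blinfun) x) = inner x (X x) - r * (norm x)\<^sup>2" for x
    by (simp add: blinfun.diff_left blinfun.scaleR_left inner_diff_right power2_norm_eq_inner)
  have "\<not> r < a"
  proof
    assume "r < a"
    then have "invertible_op (X - r *\<^sub>R id_blinfun)"
      using assms(1) by (intro coercive_imp_invertible[of "a - r"]) (simp_all add: eq algebra_simps)
    with r show False
      by (simp add: real_spectrum_iff)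
  qed
  moreover have "\<not> b < r"
  proof
    assume "b < r"
    then have "invertible_op (- (X - r *\<^sub>R id_blinfun))"
      using assms(2)
      by (intro coercive_imp_invertible[of "r - b"])
        (simp_all add: eq algebra_simps blinfun.minus_left del: minus_diff_eq)
    then have "invertible_op (- 1 *\<^sub>R - (X - r *\<^sub>R id_blinfun))"
      by (rule invertible_op_scaleR) simp
    with r show False
      by (simp add: real_spectrum_iff)
  qed
  ultimately show "r \<in> {a..b}"
    by simp
qed


section \<open>Functional calculus on an interval\<close>

text \<open>Weierstrass approximation with error \<open>1 / Suc n\<close>, brought into the form of
  the sequences over which \<open>fun_calc\<close> quantifies.\<close>

lemma uniform_limit_polynomials:
  fixes f :: "real \<Rightarrow> real"
  assumes "continuous_on {a..b} f"
  obtains p where "uniform_limit {a..b} (\<lambda>n. poly (p n)) f sequentially"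
proof -
  have "\<exists>p. \<forall>x\<in>{a..b}. \<bar>f x - poly p x\<bar> < 1 / real (Suc n)" for n
  proof -
    obtain g where g: "real_polynomial_function g" "\<And>x. x \<in> {a..b} \<Longrightarrow> \<bar>f x - g x\<bar> < 1 / real (Suc n)"
      using Stone_Weierstrass_real_polynomial_function[OF compact_Icc assms, of "1 / real (Suc n)"]
      by auto
    then obtain c d where "g = (\<lambda>x. \<Sum>i\<le>d. c i * x ^ i)"
      using real_polynomial_function_iff_sum by blast
    then have "g x = poly (\<Sum>i\<le>d. monom (c i) i) x" for x
      by (simp add: poly_sum poly_monom)
    then show ?thesis
      using g(2) by metis
  qed
  then obtain p where p: "\<And>n x. x \<in> {a..b} \<Longrightarrow> \<bar>f x - poly (p n) x\<bar> < 1 / real (Suc n)"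
    by metis
  have "uniform_limit {a..b} (\<lambda>n. poly (p n)) f sequentially"
  proof (rule uniform_limitI)
    fix e :: real assume "0 < e"
    then have "\<forall>\<^sub>F n in sequentially. 1 / real (Suc n) < e"
      using LIMSEQ_inverse_real_of_nat by (simp add: order_tendsto_iff inverse_eq_divide)
    then show "\<forall>\<^sub>F n in sequentially. \<forall>x\<in>{a..b}. dist (poly (p n) x) (f x) < e"
    proof (rule eventually_mono, intro ballI)
      show "dist (poly (p n) x) (f x) < e" if "1 / real (Suc n) < e" "x \<in> {a..b}" for n x
        using p[OF that(2), of n] that(1) by (simp add: dist_real_def abs_minus_commute)
    qed
  qed
  then show thesis
    by (rule that)
qed

text \<open>An enclosing interval stands in for the spectrum, since continuity and polynomial
  approximation are at hand there.\<close>

definition selfadjoint_between :: "real \<Rightarrow> real \<Rightarrow> ('h :: complex_hilbert \<Rightarrow>\<^sub>L 'h) \<Rightarrow> bool" where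
  "selfadjoint_between a b X \<longleftrightarrow> selfadjoint X \<and> real_spectrum X \<subseteq> {a..b}"

text \<open>On the spectrum \<open>p m - q n\<close> is eventually at most \<open>2 * e / 3\<close>,
  and \<open>norm_poly_op_le\<close> carries this over to the operators. The case
  \<open>q = p\<close> gives the Cauchy property, the general case independence of the
  sequence.\<close>

lemma poly_op_uniform_limit:
  fixes X :: "'h :: complex_hilbert \<Rightarrow>\<^sub>L 'h"
  assumes X: "selfadjoint X"
    and p: "uniform_limit (real_spectrum X) (\<lambda>n. poly (p n)) f sequentially"
    and q: "uniform_limit (real_spectrum X) (\<lambda>n. poly (q n)) f sequentially"
    and "0 < e"
  shows "\<exists>N. \<forall>m\<ge>N. \<forall>n\<ge>N. dist (poly_op (p m) X) (poly_op (q n) X) < e"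
proof -
  have "e / 3 > 0"
    using \<open>0 < e\<close> by simp
  from uniform_limitD[OF p this] uniform_limitD[OF q this]
  obtain N where N:
    "\<And>n r. n \<ge> N \<Longrightarrow> r \<in> real_spectrum X \<Longrightarrow>
      dist (poly (p n) r) (f r) < e / 3 \<and> dist (poly (q n) r) (f r) < e / 3"
    unfolding eventually_sequentially by (metis max.bounded_iff nle_le)
  have "dist (poly_op (p m) X) (poly_op (q n) X) < e" if "m \<ge> N" "n \<ge> N" for m n
  proof -
    have "norm (poly_op (p m - q n) X) \<le> 2 * e / 3"
    proof (rule norm_poly_op_le[OF X])
      show "\<bar>poly (p m - q n) r\<bar> \<le> 2 * e / 3" if "r \<in> real_spectrum X" for r
        using N[OF \<open>m \<ge> N\<close> that] N[OF \<open>n \<ge> N\<close> that]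
        unfolding dist_real_def poly_diff by linarith
    qed (use \<open>0 < e\<close> in simp)
    then show ?thesis
      using \<open>0 < e\<close> by (simp add: poly_op_diff dist_norm)
  qed
  then show ?thesis
    by blast
qed

lemma poly_op_tendsto_fun_calc:
  fixes X :: "'h :: complex_hilbert \<Rightarrow>\<^sub>L 'h"
  assumes X: "selfadjoint_between a b X" and f: "continuous_on {a..b} f"
    and p: "uniform_limit {a..b} (\<lambda>n. poly (p n)) f sequentially"
  shows "(\<lambda>n. poly_op (p n) X) \<longlonglongrightarrow> fun_calc f X"
proof -
  have sa: "selfadjoint X" and sub: "real_spectrum X \<subseteq> {a..b}"
    using X by (simp_all add: selfadjoint_between_def)
  have p': "uniform_limit (real_spectrum X) (\<lambda>n. poly (p n)) f sequentially"
    using p sub by (rule uniform_limit_on_subset)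
  have "Cauchy (\<lambda>n. poly_op (p n) X)"
    unfolding Cauchy_def using poly_op_uniform_limit[OF sa p' p'] by blast
  then obtain Y where Y: "(\<lambda>n. poly_op (p n) X) \<longlonglongrightarrow> Y"
    using Cauchy_convergent convergent_def by blast
  have lim: "(\<lambda>n. poly_op (q n) X) \<longlonglongrightarrow> Y"
    if q: "uniform_limit (real_spectrum X) (\<lambda>n. poly (q n)) f sequentially" for q
  proof -
    have "(\<lambda>n. poly_op (q n) X - poly_op (p n) X) \<longlonglongrightarrow> 0"
    proof (rule LIMSEQ_I)
      fix e :: real assume "0 < e"
      then show "\<exists>N. \<forall>n\<ge>N. norm (poly_op (q n) X - poly_op (p n) X - 0) < e"
        using poly_op_uniform_limit[OF sa q p'] by (fastforce simp: dist_norm)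
    qed
    from tendsto_add[OF this Y] show ?thesis
      by simp
  qed
  have "fun_calc f X = Y"
    unfolding fun_calc_def real_spectrum_def[symmetric]
  \<comment> \<open>Uniqueness rests on the existence of an approximating sequence: a candidate
    \<open>Z\<close> must be the limit along \<open>p\<close>, which is \<open>Y\<close>.\<close>
  proof (rule the_equality)
    show "Z = Y" if "\<forall>q. uniform_limit (real_spectrum X) (\<lambda>n. poly (q n)) f sequentially
        \<longrightarrow> (\<lambda>n. poly_op (q n) X) \<longlonglongrightarrow> Z" for Z
      using that p' Y LIMSEQ_unique by blast
  qed (use lim in blast)
  with Y show ?thesis
    by simp
qed

lemma fun_calc_eq_poly_op:
  assumes "selfadjoint_between a b X" and "\<And>x. x \<in> {a..b} \<Longrightarrow> f x = poly p x"
  shows "fun_calc f X = poly_op p X"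
proof -
  have "continuous_on {a..b} f"
    using assms(2) by (subst continuous_on_cong[OF refl, of _ _ "poly p"]) (auto intro!: continuous_intros)
  moreover have "uniform_limit {a..b} (\<lambda>n. poly p) f sequentially"
    using assms(2) by (auto intro!: uniform_limitI)
  ultimately have "(\<lambda>n. poly_op p X) \<longlonglongrightarrow> fun_calc f X"
    by (rule poly_op_tendsto_fun_calc[OF assms(1)])
  then show ?thesis
    by (simp add: LIMSEQ_const_iff)
qed

lemma fun_calc_cong:
  assumes "selfadjoint_between a b X" and "\<And>x. x \<in> {a..b} \<Longrightarrow> f x = g x"
  shows "fun_calc f X = fun_calc g X"
proof -
  have "uniform_limit {x. complex_of_real x \<in> spectrum X} h f sequentially \<longleftrightarrow>
      uniform_limit {x. complex_of_real x \<in> spectrum X} h g sequentially" for h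
    using assms by (intro uniform_limit_cong)
      (auto simp: selfadjoint_between_def real_spectrum_def)
  then show ?thesis
    by (simp add: fun_calc_def)
qed

lemma selfadjoint_fun_calc:
  assumes "selfadjoint_between a b X" and "continuous_on {a..b} f"
  shows "selfadjoint (fun_calc f X)"
proof -
  obtain p where "uniform_limit {a..b} (\<lambda>n. poly (p n)) f sequentially"
    using uniform_limit_polynomials[OF assms(2)] by blast
  from poly_op_tendsto_fun_calc[OF assms this] show ?thesis
    by (rule selfadjoint_limit[rotated])
      (use assms(1) in \<open>simp add: selfadjoint_poly_op selfadjoint_between_def\<close>)
qed

lemma fun_calc_diff:
  assumes X: "selfadjoint_between a b X"
    and f: "continuous_on {a..b} f" and g: "continuous_on {a..b} g"
  shows "fun_calc (\<lambda>x. f x - g x) X = fun_calc f X - fun_calc g X"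
proof -
  obtain p q where p: "uniform_limit {a..b} (\<lambda>n. poly (p n)) f sequentially"
    and q: "uniform_limit {a..b} (\<lambda>n. poly (q n)) g sequentially"
    using uniform_limit_polynomials[OF f] uniform_limit_polynomials[OF g] by metis
  have "uniform_limit {a..b} (\<lambda>n. poly (p n - q n)) (\<lambda>x. f x - g x) sequentially"
    using uniform_limit_minus[OF p q] unfolding poly_diff .
  then have "(\<lambda>n. poly_op (p n - q n) X) \<longlonglongrightarrow> fun_calc (\<lambda>x. f x - g x) X"
    by (intro poly_op_tendsto_fun_calc[OF X] continuous_intros f g)
  moreover have "(\<lambda>n. poly_op (p n - q n) X) \<longlonglongrightarrow> fun_calc f X - fun_calc g X"
    unfolding poly_op_diff
    by (intro tendsto_diff poly_op_tendsto_fun_calc[OF X] f g p q)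
  ultimately show ?thesis
    by (rule LIMSEQ_unique)
qed

lemma fun_calc_mult:
  assumes X: "selfadjoint_between a b X"
    and f: "continuous_on {a..b} f" and g: "continuous_on {a..b} g"
  shows "fun_calc (\<lambda>x. f x * g x) X = fun_calc f X o\<^sub>L fun_calc g X"
proof -
  obtain p q where p: "uniform_limit {a..b} (\<lambda>n. poly (p n)) f sequentially"
    and q: "uniform_limit {a..b} (\<lambda>n. poly (q n)) g sequentially"
    using uniform_limit_polynomials[OF f] uniform_limit_polynomials[OF g] by metis
  \<comment> \<open>Uniform convergence passes to products when the limits are bounded, as they are
    on a compact interval.\<close>
  have "bounded (f ` {a..b})" "bounded (g ` {a..b})"
    by (intro compact_imp_bounded compact_continuous_image f g compact_Icc)+
  from uniform_lim_mult[OF p q this]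
  have "uniform_limit {a..b} (\<lambda>n. poly (p n * q n)) (\<lambda>x. f x * g x) sequentially"
    unfolding poly_mult .
  then have "(\<lambda>n. poly_op (p n * q n) X) \<longlonglongrightarrow> fun_calc (\<lambda>x. f x * g x) X"
    by (intro poly_op_tendsto_fun_calc[OF X] continuous_intros f g)
  moreover have "(\<lambda>n. poly_op (p n * q n) X) \<longlonglongrightarrow> (fun_calc f X o\<^sub>L fun_calc g X)"
    unfolding poly_op_mult
    by (intro bounded_bilinear.tendsto[OF bounded_bilinear_blinfun_compose]
        poly_op_tendsto_fun_calc[OF X] f g p q)
  ultimately show ?thesis
    by (rule LIMSEQ_unique)
qed

text \<open>By multiplicativity \<open>f(X)\<close> is the square of the self-adjoint operator
  \<open>(sqrt f)(X)\<close>.\<close>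

lemma positive_op_fun_calc:
  assumes X: "selfadjoint_between a b X" and f: "continuous_on {a..b} f"
    and "\<And>x. x \<in> {a..b} \<Longrightarrow> 0 \<le> f x"
  shows "positive_op (fun_calc f X)"
proof -
  let ?R = "fun_calc (\<lambda>x. sqrt (f x)) X"
  have cont: "continuous_on {a..b} (\<lambda>x. sqrt (f x))"
    by (intro continuous_intros f)
  have "fun_calc f X = fun_calc (\<lambda>x. sqrt (f x) * sqrt (f x)) X"
    using assms(3) by (intro fun_calc_cong[OF X]) simp
  also have "\<dots> = ?R o\<^sub>L ?R"
    by (rule fun_calc_mult[OF X cont cont])
  finally have "fun_calc f X = ?R o\<^sub>L ?R" .
  moreover have "inner x (?R (?R x)) = inner (?R x) (?R x)" for x
    by (simp add: selfadjoint_inner selfadjoint_fun_calc[OF X cont])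
  ultimately show ?thesis
    using selfadjoint_fun_calc[OF X f] by (simp add: positive_op_def Re_cinner)
qed


section \<open>Comparison of the entropies\<close>

lemma continuous_on_ln_t:
  assumes "0 < m"
  shows "continuous_on {m..M} (ln_t t)"
proof (cases "t = 0")
  case True
  then have "ln_t t = ln"
    by (auto simp: ln_t_def)
  then show ?thesis
    using assms by (auto intro!: continuous_intros)
next
  case False
  then have "ln_t t = (\<lambda>x. (x powr t - 1) / t)"
    by (auto simp: ln_t_def)
  then show ?thesis
    using assms False by (auto intro!: continuous_intros)
qed

text \<open>The constant \<open>c\<close> is left free so that all three claims are instances, with
  \<open>c\<close> a value of \<open>theta_quot\<close> or \<open>0\<close>.\<close>

lemma rel_entropy_le_tsallis_if:
  fixes A B :: "'h :: complex_hilbert \<Rightarrow>\<^sub>L 'h"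
  assumes A: "positive_op A" "invertible_op A" and B: "positive_op B" and "0 < m"
    and lower: "m *\<^sub>R A \<preceq> B" and upper: "B \<preceq> M *\<^sub>R A"
    and le: "\<And>x. x \<in> {m..M} \<Longrightarrow> ln x + c \<le> ln_t t x"
  shows "rel_entropy A B + c *\<^sub>R A \<preceq> tsallis_rel_entropy t A B"
proof -
  \<comment> \<open>A positive lower bound keeps the interval around the spectrum of
    \<open>A\<close> away from \<open>0\<close>, where negative powers are not continuous.\<close>
  obtain \<delta> where \<delta>: "\<delta> > 0" "\<And>x. \<delta> * (norm x)\<^sup>2 \<le> inner x (A x)"
    using positive_invertible_imp_coercive[OF A] by blast
  let ?I = "{\<delta>..norm A}"
  have "inner x (A x) \<le> norm A * (norm x)\<^sup>2" for x
    using order_trans[OF norm_cauchy_schwarz mult_left_mono[OF norm_blinfun[of A x] norm_ge_zero]]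
    by (simp add: power2_eq_square ac_simps)
  then have A_between: "selfadjoint_between \<delta> (norm A) A"
    using A(1) \<delta>(2) real_spectrum_subset
    unfolding selfadjoint_between_def positive_op_def by blast
  define R where "R = op_powr A (1/2)"
  define Q where "Q = op_powr A (-1/2)"
  have cont: "continuous_on ?I (\<lambda>x. x powr r)" for r :: real
    using \<delta>(1) by (auto intro!: continuous_intros)
  have R: "selfadjoint R" and Q: "selfadjoint Q"
    by (simp_all only: R_def Q_def op_powr_def selfadjoint_fun_calc[OF A_between cont])
  have compose: "op_powr A r o\<^sub>L op_powr A s = fun_calc (\<lambda>x. x powr (r + s)) A" for r s
    unfolding op_powr_def powr_add by (rule fun_calc_mult[OF A_between cont cont, symmetric])
  have "R o\<^sub>L R = poly_op [:0, 1:] A"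
    unfolding R_def compose using \<delta>(1) by (intro fun_calc_eq_poly_op[OF A_between]) auto
  then have RR: "R (R x) = A x" for x
    by (metis blinfun_apply_blinfun_compose poly_op_X)
  \<comment> \<open>Since \<open>0 powr 0 = 0\<close>, this too relies on the interval lying to the
    right of \<open>0\<close>.\<close>
  have "fun_calc (\<lambda>x. x powr 0) A = id_blinfun"
    using fun_calc_eq_poly_op[OF A_between, of "\<lambda>x. x powr 0" "[:1:]"] \<delta>(1) by simp
  then have "R o\<^sub>L Q = id_blinfun" "Q o\<^sub>L R = id_blinfun"
    by (simp_all add: R_def Q_def compose)
  then have RQ: "R (Q x) = x" and QR: "Q (R x) = x" for x
    by (metis blinfun_apply_blinfun_compose blinfun_apply_id_blinfun)+
  define C where "C = Q o\<^sub>L B o\<^sub>L Q"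
  have C_form: "inner x (C x) = inner (Q x) (B (Q x))" for x
    by (simp add: C_def selfadjoint_inner[OF Q])
  \<comment> \<open>As \<open>A = R R\<close> and \<open>Q\<close> inverts \<open>R\<close>, the
    operator \<open>Q A Q\<close> is the identity. Testing the two order hypotheses at
    \<open>Q x\<close> therefore bounds \<open>C\<close> by \<open>m\<close> and
    \<open>M\<close>.\<close>
  have A_form: "inner (Q x) (A (Q x)) = (norm x)\<^sup>2" for x
    by (simp add: selfadjoint_inner[OF Q] QR RQ power2_norm_eq_inner flip: RR)
  have "m * (norm x)\<^sup>2 \<le> inner x (C x)" for x
    using positive_op_inner[OF lower[unfolded loewner_le_def], of "Q x"]
    by (simp add: C_form A_form blinfun.diff_left blinfun.scaleR_left inner_diff_right)
  moreover have "inner x (C x) \<le> M * (norm x)\<^sup>2" for x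
    using positive_op_inner[OF upper[unfolded loewner_le_def], of "Q x"]
    by (simp add: C_form A_form blinfun.diff_left blinfun.scaleR_left inner_diff_right)
  moreover have "selfadjoint C"
    using B by (simp add: C_def positive_op_def selfadjoint_sandwich Q)
  ultimately have C: "selfadjoint_between m M C"
    using real_spectrum_subset unfolding selfadjoint_between_def by blast
  have ln_cont: "continuous_on {m..M} ln" "continuous_on {m..M} (\<lambda>x. ln_t t x - ln x)"
    using \<open>0 < m\<close> continuous_on_ln_t[OF \<open>0 < m\<close>] by (auto intro!: continuous_intros)
  have "fun_calc (\<lambda>x. ln_t t x - ln x - c) C = fun_calc (ln_t t) C - fun_calc ln C - fun_calc (\<lambda>x. c) C"
    using ln_cont continuous_on_ln_t[OF \<open>0 < m\<close>] by (simp add: fun_calc_diff[OF C])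
  also have "fun_calc (\<lambda>x. c) C = c *\<^sub>R id_blinfun"
    using fun_calc_eq_poly_op[OF C, of "\<lambda>x. c" "[:c:]"] by simp
  finally have D: "fun_calc (\<lambda>x. ln_t t x - ln x - c) C =
      fun_calc (ln_t t) C - fun_calc ln C - c *\<^sub>R id_blinfun" .
  have "positive_op (fun_calc (\<lambda>x. ln_t t x - ln x - c) C)"
  proof (rule positive_op_fun_calc[OF C])
    show "0 \<le> ln_t t x - ln x - c" if "x \<in> {m..M}" for x
      using le[OF that] by linarith
  qed (intro continuous_intros ln_cont)
  then have "positive_op (R o\<^sub>L fun_calc (\<lambda>x. ln_t t x - ln x - c) C o\<^sub>L R)"
    by (rule positive_op_sandwich[OF R])
  \<comment> \<open>Conjugation by \<open>R\<close> turns the scalar \<open>c\<close> into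
    \<open>c *\<^sub>R A\<close>, because \<open>R R = A\<close>.\<close>
  moreover have "R o\<^sub>L fun_calc (\<lambda>x. ln_t t x - ln x - c) C o\<^sub>L R =
      tsallis_rel_entropy t A B - (rel_entropy A B + c *\<^sub>R A)"
    unfolding D tsallis_rel_entropy_def rel_entropy_def R_def[symmetric] Q_def[symmetric]
      C_def[symmetric]
    by (rule blinfun_eqI)
      (simp add: blinfun.diff_left blinfun.diff_right blinfun.add_left blinfun.scaleR_left
        blinfun.scaleR_right RR)
  ultimately show ?thesis
    by (simp add: loewner_le_def)
qed

text \<open>In this form the sign of the derivative is that of \<open>x powr t - 1\<close>, and the
  formula covers \<open>t = 0\<close>, where the difference is constantly \<open>0\<close>.\<close>

lemma ln_t_minus_ln_has_derivative:
  assumes "0 < x"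
  shows "((\<lambda>x. ln_t t x - ln x) has_real_derivative (x powr t - 1) / x) (at x)"
proof (cases "t = 0")
  case True
  then show ?thesis
    using assms by (simp add: ln_t_def)
next
  case False
  have "((\<lambda>x. (x powr t - 1) / t - ln x) has_real_derivative x powr (t - 1) - 1 / x) (at x)"
    using assms False by (auto intro!: derivative_eq_intros)
  then show ?thesis
    using assms False by (simp add: ln_t_def powr_diff diff_divide_distrib)
qed

lemma ln_t_minus_ln_antimono:
  assumes "0 \<le> t" and "0 < x" and "x \<le> y" and "y \<le> 1"
  shows "ln_t t y - ln y \<le> ln_t t x - ln x"
proof (rule DERIV_nonpos_imp_nonincreasing[OF assms(3)])
  show "\<exists>d. ((\<lambda>x. ln_t t x - ln x) has_real_derivative d) (at z) \<and> d \<le> 0" if "x \<le> z" "z \<le> y" for z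
    using that assms ln_t_minus_ln_has_derivative[of z t] powr_le1[of t z]
    by (intro exI[of _ "(z powr t - 1) / z"]) (auto simp: divide_nonpos_pos)
qed

lemma ln_t_minus_ln_mono:
  assumes "0 \<le> t" and "1 \<le> x" and "x \<le> y"
  shows "ln_t t x - ln x \<le> ln_t t y - ln y"
proof (rule DERIV_nonneg_imp_nondecreasing[OF assms(3)])
  show "\<exists>d. ((\<lambda>x. ln_t t x - ln x) has_real_derivative d) (at z) \<and> d \<ge> 0" if "x \<le> z" "z \<le> y" for z
    using that assms ln_t_minus_ln_has_derivative[of z t] ge_one_powr_ge_zero[of z t]
    by (intro exI[of _ "(z powr t - 1) / z"]) auto
qed

text \<open>The difference falls up to \<open>1\<close>, rises afterwards, and is \<open>0\<close>
  at \<open>1\<close>.\<close>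

lemma ln_le_ln_t:
  assumes "0 \<le> t" and "0 < x"
  shows "ln x \<le> ln_t t x"
proof -
  have "ln_t t 1 = 0"
    by (simp add: ln_t_def)
  then show ?thesis
    using ln_t_minus_ln_antimono[OF assms(1), of x 1] ln_t_minus_ln_mono[OF assms(1), of 1 x] assms(2)
    by (cases "x \<le> 1") simp_all
qed

text \<open>With \<open>d = ln_t t x - ln x\<close> this is \<open>min (d\<^sup>2) (t\<^sup>2) \<le> d t\<close>.\<close>

lemma theta_quot_le:
  assumes "0 \<le> t" and "0 < x"
  shows "theta_quot t x \<le> ln_t t x - ln x"
proof (cases "t = 0")
  case True
  then show ?thesis
    by (simp add: theta_quot_def ln_t_def)
next
  case False
  define d where "d = ln_t t x - ln x"
  have "0 \<le> d"
    using ln_le_ln_t[OF assms] by (simp add: d_def)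
  \<comment> \<open>If \<open>d \<le> t\<close>, then \<open>d^2 \<le> d * t\<close>; otherwise
    \<open>t^2 \<le> d * t\<close>.\<close>
  then have "min (d\<^sup>2) (t\<^sup>2) \<le> d * t"
    using assms(1) by (cases "d \<le> t") (auto simp: power2_eq_square min_le_iff_disj intro: mult_left_mono mult_right_mono)
  then show ?thesis
    using False assms(1) by (simp add: theta_quot_def theta_def pos_divide_le_eq flip: d_def)
qed

theorem theorem3p3:
  fixes A B :: "'h :: complex_hilbert \<Rightarrow>\<^sub>L 'h" and m M t :: real
  assumes "positive_op A" and "invertible_op A"
    and "positive_op B" and "invertible_op B"
    and "0 < m" and "m \<le> M"
    and "m *\<^sub>R A \<preceq> B" and "B \<preceq> M *\<^sub>R A"
    and "0 \<le> t" and "t \<le> 1"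
  shows "(M < 1 \<longrightarrow> rel_entropy A B + theta_quot t M *\<^sub>R A \<preceq> tsallis_rel_entropy t A B)
    \<and> (m \<le> 1 \<and> 1 \<le> M \<longrightarrow> rel_entropy A B \<preceq> tsallis_rel_entropy t A B)
    \<and> (1 < m \<longrightarrow> rel_entropy A B + theta_quot t m *\<^sub>R A \<preceq> tsallis_rel_entropy t A B)"
proof -
  note compare = rel_entropy_le_tsallis_if[OF assms(1-3,5,7,8)]
  have "rel_entropy A B + theta_quot t M *\<^sub>R A \<preceq> tsallis_rel_entropy t A B" if "M < 1"
  proof (rule compare)
    show "ln x + theta_quot t M \<le> ln_t t x" if "x \<in> {m..M}" for x
      using that \<open>M < 1\<close> \<open>0 < m\<close> theta_quot_le[OF \<open>0 \<le> t\<close>, of M]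
        ln_t_minus_ln_antimono[OF \<open>0 \<le> t\<close>, of x M] by auto
  qed
  \<comment> \<open>The instance \<open>c = 0\<close>, whose extra term is simplified away at the
    end.\<close>
  moreover have "rel_entropy A B + 0 *\<^sub>R A \<preceq> tsallis_rel_entropy t A B"
    by (rule compare) (use ln_le_ln_t[OF \<open>0 \<le> t\<close>] \<open>0 < m\<close> in auto)
  moreover have "rel_entropy A B + theta_quot t m *\<^sub>R A \<preceq> tsallis_rel_entropy t A B" if "1 < m"
  proof (rule compare)
    show "ln x + theta_quot t m \<le> ln_t t x" if "x \<in> {m..M}" for x
      using that \<open>1 < m\<close> theta_quot_le[OF \<open>0 \<le> t\<close>, of m]
        ln_t_minus_ln_mono[OF \<open>0 \<le> t\<close>, of m x] by auto
  qed
  ultimately show ?thesis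
    by simp
qed

end
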